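(* Let $m\ge2$ and $m<r<2m$. Then there is no independent exact $r$-cover of $\mathbb Z^m$.
   Context: $\mathbb Z^m$ is the infinite grid graph: two points are adjacent iff they differ by $\pm1$ in exactly one coordinate. For a $d$-regular graph $G$ and $0\le r\le d$, a set $S\subseteq V(G)$ is an independent exact $r$-cover if $S$ is an independent set and every vertex not in $S$ is adjacent to exactly $r$ elements of $S$. *)

theory Defs
  imports "HOL-Analysis.Finite_Cartesian_Product"
begin

definition neighbours :: "'a set \<Rightarrow> ('a \<Rightarrow> 'a \<Rightarrow> bool) \<Rightarrow> 'a \<Rightarrow> 'a set" where
  "neighbours V adj v = {w \<in> V. adj v w}"

definition simple_graph :: "'a set \<Rightarrow> ('a \<Rightarrow> 'a \<Rightarrow> bool) \<Rightarrow> bool" where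
  "simple_graph V adj \<longleftrightarrow> (\<forall>v\<in>V. \<not> adj v v) \<and> (\<forall>v\<in>V. \<forall>w\<in>V. adj v w \<longrightarrow> adj w v)"

text \<open>The vertex set may be infinite, but regularity includes local finiteness;
  the latter is stated separately because \<open>card\<close> is 0 on infinite sets.\<close>

definition regular_graph :: "'a set \<Rightarrow> ('a \<Rightarrow> 'a \<Rightarrow> bool) \<Rightarrow> nat \<Rightarrow> bool" where
  "regular_graph V adj d \<longleftrightarrow> simple_graph V adj \<and>
     (\<forall>v\<in>V. finite (neighbours V adj v) \<and> card (neighbours V adj v) = d)"

definition independent_set :: "'a set \<Rightarrow> ('a \<Rightarrow> 'a \<Rightarrow> bool) \<Rightarrow> 'a set \<Rightarrow> bool" where
  "independent_set V adj S \<longleftrightarrow> S \<subseteq> V \<and> (\<forall>v\<in>S. \<forall>w\<in>S. \<not> adj v w)"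

definition independent_exact_cover ::
  "'a set \<Rightarrow> ('a \<Rightarrow> 'a \<Rightarrow> bool) \<Rightarrow> nat \<Rightarrow> 'a set \<Rightarrow> bool" where
  "independent_exact_cover V adj r S \<longleftrightarrow> independent_set V adj S \<and>
     (\<forall>v\<in>V - S. card (neighbours V adj v \<inter> S) = r)"

definition grid_adj :: "int ^ 'm \<Rightarrow> int ^ 'm \<Rightarrow> bool" where
  "grid_adj x y \<longleftrightarrow> (\<exists>i. \<bar>x $ i - y $ i\<bar> = 1 \<and> (\<forall>j. j \<noteq> i \<longrightarrow> x $ j = y $ j))"

lemma neighbours_grid:
  "neighbours UNIV grid_adj (x :: int ^ 'm) = (\<lambda>(i, s). x + axis i s) ` (UNIV \<times> {1, -1})"
proof (intro equalityI subsetI)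
  fix y assume "y \<in> neighbours UNIV grid_adj x"
  then obtain i where i: "\<bar>x $ i - y $ i\<bar> = 1" "\<And>j. j \<noteq> i \<Longrightarrow> x $ j = y $ j"
    by (auto simp: neighbours_def grid_adj_def)
  have "y = x + axis i (y $ i - x $ i)"
    using i(2) by (auto simp: vec_eq_iff axis_def)
  moreover have "y $ i - x $ i \<in> {1, -1}"
    using i(1) by auto
  ultimately show "y \<in> (\<lambda>(i, s). x + axis i s) ` (UNIV \<times> {1, -1})"
    by (intro image_eqI[of _ _ "(i, y $ i - x $ i)"]) auto
next
  fix y assume "y \<in> (\<lambda>(i, s). x + axis i s) ` (UNIV \<times> {1, -1})"
  then obtain i s where "y = x + axis i s" "s \<in> {1, -1}" by auto
  then have "\<bar>x $ i - y $ i\<bar> = 1 \<and> (\<forall>j. j \<noteq> i \<longrightarrow> x $ j = y $ j)"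
    by (auto simp: axis_def)
  then show "y \<in> neighbours UNIV grid_adj x"
    by (auto simp: neighbours_def grid_adj_def)
qed

lemma regular_grid:
  "regular_graph UNIV (grid_adj :: int ^ 'm \<Rightarrow> int ^ 'm \<Rightarrow> bool) (2 * CARD('m))"
proof -
  have "simple_graph UNIV (grid_adj :: int ^ 'm \<Rightarrow> int ^ 'm \<Rightarrow> bool)"
    unfolding simple_graph_def grid_adj_def by (auto simp: abs_minus_commute)
  moreover have "inj_on (\<lambda>(i, s). x + axis i s) (UNIV \<times> {1, -1})" for x :: "int ^ 'm"
    by (auto simp: inj_on_def axis_eq_axis)
  ultimately show ?thesis
    by (auto simp: regular_graph_def neighbours_grid card_image card_cartesian_product)
qed

end

theory Submission
  imports Defs
begin

text \<open>If two adjacent vertices \<open>v, w\<close> both lie outside \<open>S\<close>, then translation by \<open>w - v\<close> carries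
  the \<open>r\<close> neighbours of \<open>v\<close> in \<open>S\<close> to neighbours of \<open>w\<close> outside \<open>S\<close>, because it moves every point
  to an adjacent one. With the \<open>r\<close> neighbours of \<open>w\<close> in \<open>S\<close> this gives \<open>2 r \<le> 2 m\<close>. Such
  \<open>v, w\<close> exist as soon as \<open>r < 2 m\<close>.\<close>

lemma grid_adj_translate:
  "grid_adj (x + d) (y + d) \<longleftrightarrow> grid_adj x y"
  by (simp add: grid_adj_def)

lemma exact_cover_adjacent_outside_le:
  fixes S :: "(int ^ 'm::finite) set"
  assumes cover: "independent_exact_cover UNIV grid_adj r S"
    and "v \<notin> S" "w \<notin> S" and adj: "grid_adj v w"
  shows "r \<le> CARD('m)"
proof -
  let ?N = "neighbours UNIV (grid_adj :: int ^ 'm \<Rightarrow> _)"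
  let ?t = "\<lambda>x. x + (w - v)"
  have fin: "finite (?N w)" and deg: "card (?N w) = 2 * CARD('m)"
    using regular_grid by (auto simp: regular_graph_def)
  \<comment> \<open>Translating the edge from \<open>v\<close> to \<open>w\<close> by
    \<open>x - v\<close> gives an edge from \<open>x\<close> to \<open>?t x\<close>.\<close>
  have shift: "grid_adj x (?t x)" for x
    using adj grid_adj_translate[of v "x - v" w] by (simp add: algebra_simps)
  have image: "?t ` (?N v \<inter> S) \<subseteq> ?N w - S"
  proof
    fix y assume "y \<in> ?t ` (?N v \<inter> S)"
    then obtain x where x: "x \<in> S" "grid_adj v x" "y = ?t x"
      by (auto simp: neighbours_def)
    have "grid_adj w y"
      using x grid_adj_translate[of v "w - v" x] by simp
    moreover have "y \<notin> S"
      using cover x(1,3) shift[of x]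
      by (auto simp: independent_exact_cover_def independent_set_def)
    ultimately show "y \<in> ?N w - S"
      by (simp add: neighbours_def)
  qed
  have "card (?t ` (?N v \<inter> S)) = card (?N v \<inter> S)"
    by (rule card_image) (simp add: inj_on_def)
  then have "r + r = card (?t ` (?N v \<inter> S)) + card (?N w \<inter> S)"
    using cover assms(2,3) by (simp add: independent_exact_cover_def)
  also have "\<dots> \<le> card (?N w - S) + card (?N w \<inter> S)"
    using image fin by (simp add: card_mono)
  also have "\<dots> = 2 * CARD('m)"
    using card_Int_Diff[OF fin, of S] deg by simp
  finally show ?thesis by simp
qed

theorem theorem6:
  fixes r :: nat
  assumes "CARD('m::finite) \<ge> 2"
    and "CARD('m) < r" and "r < 2 * CARD('m)"
  shows "\<not> (\<exists>S :: (int ^ 'm) set. independent_exact_cover UNIV grid_adj r S)"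
proof
  assume "\<exists>S :: (int ^ 'm) set. independent_exact_cover UNIV grid_adj r S"
  then obtain S :: "(int ^ 'm) set" where cover: "independent_exact_cover UNIV grid_adj r S"
    by blast
  let ?N = "neighbours UNIV (grid_adj :: int ^ 'm \<Rightarrow> _)"
  have deg: "card (?N x) = 2 * CARD('m)" for x
    using regular_grid by (auto simp: regular_graph_def)
  \<comment> \<open>The degree is positive, so there is an edge at \<open>0\<close>; by independence
    its two ends cannot both lie in \<open>S\<close>.\<close>
  have "?N 0 \<noteq> {}"
    using deg[of 0] by auto
  then obtain v where v: "v \<notin> S"
    using cover
    by (auto simp: neighbours_def independent_exact_cover_def independent_set_def)
  \<comment> \<open>Only \<open>r\<close> of the \<open>2 * CARD('m)\<close> neighbours of
    \<open>v\<close> lie in \<open>S\<close>, so some neighbour \<open>w\<close> is outside, and the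
    bound \<open>r \<le> CARD('m)\<close> applies to \<open>v\<close> and \<open>w\<close>.\<close>
  then have "card (?N v \<inter> S) < card (?N v)"
    using cover deg assms(3) by (simp add: independent_exact_cover_def)
  then have "?N v \<inter> S \<noteq> ?N v"
    by auto
  then obtain w where "w \<notin> S" "grid_adj v w"
    by (auto simp: neighbours_def)
  with exact_cover_adjacent_outside_le[OF cover v] assms(2) show False
    by simp
qed

end
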